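(* Let $n\ge 2$, let $(X_i,d_i)$ be geodesic spaces, let $x_i,y_i\in X_i$, and let $\sigma_i:[0,1]\to X_i$ be an affinely geodesic with $\sigma_i(0)=x_i$ and $\sigma_i(1)=y_i$ $(i=1,\ldots,n)$. Let $x:=(x_1,\ldots,x_n)$, $y:=(y_1,\ldots,y_n)$, $M:=X_1\times\cdots\times X_n$, $\psi\in\mathbf{\Psi}_n$, and $\sigma:=(\sigma_1,\ldots,\sigma_n):[0,1]\to M$. Then $\sigma$ is an affinely geodesic joining $x$ and $y$ in the geodesic space $(M,d_\psi)$, and $$L(\sigma)=\left(\sum_{i=1}^n L(\sigma_i)\right)\cdot\psi\left(\frac{L(\sigma_1)}{\sum_{i=1}^n L(\sigma_i)},\ldots,\frac{L(\sigma_n)}{\sum_{i=1}^n L(\sigma_i)}\right),$$ where the right-hand side is read as $0$ when $\sum_{i=1}^n L(\sigma_i)=0$.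
   Context: For $n\ge 2$, let $\Omega_n:=\{(t_1,\ldots,t_n)\in\mathbb{R}^n \mid t_i\ge 0,\ \sum_{i=1}^n t_i=1\}$. The class $\mathbf{\Psi}_n$ consists of all continuous convex functions $\psi:\Omega_n\to\mathbb{R}$ such that $\psi(\mathbf{e}_1)=\cdots=\psi(\mathbf{e}_n)=1$, where $\mathbf{e}_1,\ldots,\mathbf{e}_n$ are the standard basis vectors of $\mathbb{R}^n$, and $$\psi(t_1,\ldots,t_n)\ge (1-t_i)\cdot\psi\left(\frac{t_1}{1-t_i},\ldots,\frac{t_{i-1}}{1-t_i},0,\frac{t_{i+1}}{1-t_i},\ldots,\frac{t_n}{1-t_i}\right)$$ for every $i=1,\ldots,n$ and all $(t_1,\ldots,t_n)\in\Omega_n$ with $t_i<1$. For metric spaces $(X_i,d_i)$ and $\psi\in\mathbf{\Psi}_n$, the metric $d_\psi$ on $M=X_1\times\cdots\times X_n$ is defined by $d_\psi(x,y):=0$ if $x=y$ and, for $x=(x_1,\ldots,x_n)\ne y=(y_1,\ldots,y_n)$, with $D:=\sum_{i=1}^n d_i(x_i,y_i)$, $$d_\psi(x,y):=D\cdot\psi\left(\frac{d_1(x_1,y_1)}{D},\ldots,\frac{d_n(x_n,y_n)}{D}\right).$$ A curve in a metric space $(X,d)$ is a continuous map $\sigma:[a,b]\to X$ with $a\le b$ real; it joins $\sigma(a)$ and $\sigma(b)$. Its length is $L(\sigma):=\sup\sum_{i=1}^{m} d(\sigma(t_{i-1}),\sigma(t_i))$, the supremum being over all partitions $a=t_0<t_1<\cdots<t_m=b$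 of $[a,b]$ (the supremum over the empty set is $0$); for a curve in $M$ the length is taken with respect to $d_\psi$. A curve $\sigma:[a,b]\to X$ is a geodesic if $d(\sigma(t),\sigma(t'))=|t-t'|$ for all $t,t'\in[a,b]$. A metric space $(X,d)$ is a geodesic space if for any $x,y\in X$ there exists a geodesic $\gamma:[0,d(x,y)]\to X$ with $\gamma(0)=x$ and $\gamma(d(x,y))=y$. A curve $\sigma:[a,b]\to X$ is called an affinely geodesic if either $\sigma$ is constant or there exists a geodesic $\sigma':[c,d]\to X$ such that $\sigma=\sigma'\circ\theta$, where $\theta:[a,b]\to[c,d]$ is given by $\theta(t):=\frac{(d-c)t+bc-ad}{b-a}$ for all $t\in[a,b]$ (here $c,d$ denote real endpoints). *)

theory Defs
  imports "HOL-Analysis.Analysis"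
begin

text \<open>
  The coordinates \<open>1, \<dots>, n\<close> are the elements of a finite type \<open>'n\<close>.  Metric spaces are pairs of a
  carrier \<open>X\<close> and a distance \<open>d\<close> satisfying the library's \<open>Metric_space X d\<close>; the factors of a product
  are carriers \<open>X i\<close> inside one common type, which can always be arranged by a disjoint union.
\<close>

definition simplex_Omega :: "(real ^ 'n) set" where
  "simplex_Omega = {t. (\<forall>i. 0 \<le> t $ i) \<and> (\<Sum>i\<in>UNIV. t $ i) = 1}"

text \<open>Only the values on \<open>simplex_Omega\<close> matter; outside it members of \<open>Psi\<close> are arbitrary.\<close>

definition Psi :: "(real ^ 'n \<Rightarrow> real) set" where
  "Psi = {\<psi>. continuous_on simplex_Omega \<psi> \<and> convex_on simplex_Omega \<psi> \<and>
     (\<forall>i. \<psi> (axis i 1) = 1) \<and>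
     (\<forall>i. \<forall>t\<in>simplex_Omega. t $ i < 1 \<longrightarrow>
        \<psi> t \<ge> (1 - t $ i) * \<psi> (\<chi> j. if j = i then 0 else t $ j / (1 - t $ i)))}"

definition prod_carrier :: "('n \<Rightarrow> 'a set) \<Rightarrow> ('n \<Rightarrow> 'a) set" where
  "prod_carrier X = (\<Pi>\<^sub>E i\<in>UNIV. X i)"

definition psi_dist ::
    "(real ^ 'n \<Rightarrow> real) \<Rightarrow> ('n \<Rightarrow> 'a \<Rightarrow> 'a \<Rightarrow> real) \<Rightarrow> ('n \<Rightarrow> 'a) \<Rightarrow> ('n \<Rightarrow> 'a) \<Rightarrow> real" where
  "psi_dist \<psi> d x y =
     (if x = y then 0
      else let D = (\<Sum>i\<in>UNIV. d i (x i) (y i)) in D * \<psi> (\<chi> i. d i (x i) (y i) / D))"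

text \<open>
  A curve with domain \<open>[a, b]\<close> is a total function of which only the values on \<open>{a..b}\<close> are
  relevant, so the end points are explicit arguments below.
\<close>

definition curve :: "'a set \<Rightarrow> ('a \<Rightarrow> 'a \<Rightarrow> real) \<Rightarrow> real \<Rightarrow> real \<Rightarrow> (real \<Rightarrow> 'a) \<Rightarrow> bool" where
  "curve X d a b \<sigma> \<longleftrightarrow>
     a \<le> b \<and> continuous_map (top_of_set {a..b}) (Metric_space.mtopology X d) \<sigma>"

text \<open>
  The length may be infinite.  In \<open>ennreal\<close> the supremum of the empty set is \<open>0\<close>, which is the
  convention wanted for \<open>a = b\<close>.
\<close>

definition curve_length ::
    "('a \<Rightarrow> 'a \<Rightarrow> real) \<Rightarrow> real \<Rightarrow> real \<Rightarrow> (real \<Rightarrow> 'a) \<Rightarrow> ennreal" where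
  "curve_length d a b \<sigma> =
     Sup {(\<Sum>i=1..m. ennreal (d (\<sigma> (t (i - 1))) (\<sigma> (t i)))) | (m::nat) (t :: nat \<Rightarrow> real).
            1 \<le> m \<and> t 0 = a \<and> t m = b \<and> (\<forall>i\<in>{1..m}. t (i - 1) < t i)}"

definition geodesic :: "'a set \<Rightarrow> ('a \<Rightarrow> 'a \<Rightarrow> real) \<Rightarrow> real \<Rightarrow> real \<Rightarrow> (real \<Rightarrow> 'a) \<Rightarrow> bool" where
  "geodesic X d a b \<sigma> \<longleftrightarrow>
     curve X d a b \<sigma> \<and> (\<forall>t\<in>{a..b}. \<forall>t'\<in>{a..b}. d (\<sigma> t) (\<sigma> t') = \<bar>t - t'\<bar>)"

definition geodesic_space :: "'a set \<Rightarrow> ('a \<Rightarrow> 'a \<Rightarrow> real) \<Rightarrow> bool" where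
  "geodesic_space X d \<longleftrightarrow>
     Metric_space X d \<and>
     (\<forall>x\<in>X. \<forall>y\<in>X. \<exists>\<gamma>. geodesic X d 0 (d x y) \<gamma> \<and> \<gamma> 0 = x \<and> \<gamma> (d x y) = y)"

text \<open>
  For \<open>a = b\<close> the curve is constant and the first disjunct applies, so the division by \<open>b - a\<close> in the
  second one is harmless.
\<close>

definition affinely_geodesic ::
    "'a set \<Rightarrow> ('a \<Rightarrow> 'a \<Rightarrow> real) \<Rightarrow> real \<Rightarrow> real \<Rightarrow> (real \<Rightarrow> 'a) \<Rightarrow> bool" where
  "affinely_geodesic X d a b \<sigma> \<longleftrightarrow>
     curve X d a b \<sigma> \<and>
     (\<sigma> constant_on {a..b} \<or>
      (\<exists>c e \<sigma>'. geodesic X d c e \<sigma>' \<and>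
         (\<forall>t\<in>{a..b}. \<sigma> t = \<sigma>' (((e - c) * t + b * c - a * e) / (b - a)))))"

end

theory Submission
  imports Defs
begin

text \<open>
  Extend \<open>\<psi>\<close> from the simplex to the nonnegative orthant by homogeneity.  The extension is a
  sublinear function, and the last condition defining \<open>Psi\<close> says that it does not increase when a
  coordinate is replaced by \<open>0\<close>.  A convex function on a half-line that is minimal at the end point is
  nondecreasing, so the extension is monotone in every coordinate (\<open>hom_ext_mono\<close>).  Since the
  \<open>\<psi>\<close>-distance is this extension applied to the vector of coordinate distances, sublinearity and
  monotonicity give the triangle inequality, and the bound \<open>hom_ext_ge_coordinate\<close> separates points.

  A curve on \<open>[a, b]\<close> with \<open>a < b\<close> is affinely geodesic exactly if the distance of \<open>\<sigma> t\<close> and \<open>\<sigma> t'\<close> is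
  \<open>v * \<bar>t - t'\<bar>\<close> for a fixed speed \<open>v \<ge> 0\<close>.  Homogeneity shows at once
  that curves with speeds \<open>v i\<close> in the factors form a curve in the product whose speed is the extension
  evaluated at \<open>v\<close>.  On \<open>[0, 1]\<close> the length of such a curve is its speed, because every partition gives the
  same sum; hence the formula for the length is the formula for the speed.
\<close>

section \<open>The homogeneous extension of a function on the simplex\<close>

text \<open>At \<open>0\<close> the division by zero is absorbed by the vanishing first factor.\<close>

definition hom_ext :: "(real ^ 'n \<Rightarrow> real) \<Rightarrow> real ^ 'n \<Rightarrow> real" where
  "hom_ext \<psi> s = (let S = (\<Sum>i\<in>UNIV. s $ i) in S * \<psi> (\<chi> i. s $ i / S))"

lemma hom_ext_zero [simp]: "hom_ext \<psi> 0 = 0"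
  by (simp add: hom_ext_def)

lemma hom_ext_scaleR: "hom_ext \<psi> (c *\<^sub>R s) = c * hom_ext \<psi> s"
proof (cases "c = 0")
  case False
  then show ?thesis
    by (simp add: hom_ext_def Let_def flip: sum_distrib_left)
qed simp

lemma sum_coordinates_eq_0_iff:
  fixes s :: "real ^ 'n"
  assumes "\<And>i. 0 \<le> s $ i"
  shows "(\<Sum>i\<in>UNIV. s $ i) = 0 \<longleftrightarrow> s = 0"
  using assms by (simp add: sum_nonneg_eq_0_iff vec_eq_iff)

lemma normalized_in_simplex:
  fixes s :: "real ^ 'n"
  assumes "\<And>i. 0 \<le> s $ i" "s \<noteq> 0"
  shows "(\<chi> i. s $ i / (\<Sum>j\<in>UNIV. s $ j)) \<in> simplex_Omega"
  using assms sum_coordinates_eq_0_iff[of s]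
  by (auto simp: simplex_Omega_def sum_nonneg simp flip: sum_divide_distrib)

text \<open>
  The normalisation of \<open>s + t\<close> is the convex combination of the normalisations of \<open>s\<close> and \<open>t\<close>, weighted by
  their coordinate sums; so convexity on the simplex becomes subadditivity.
\<close>

lemma hom_ext_add_le:
  fixes s t :: "real ^ 'n"
  assumes \<psi>: "\<psi> \<in> Psi" and s: "\<And>i. 0 \<le> s $ i" and t: "\<And>i. 0 \<le> t $ i"
  shows "hom_ext \<psi> (s + t) \<le> hom_ext \<psi> s + hom_ext \<psi> t"
proof (cases "s = 0 \<or> t = 0")
  case False
  define S T where "S = (\<Sum>i\<in>UNIV. s $ i)" and "T = (\<Sum>i\<in>UNIV. t $ i)"
  define p q :: "real ^ 'n" where "p = (\<chi> i. s $ i / S)" and "q = (\<chi> i. t $ i / T)"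
  have "S \<noteq> 0" "T \<noteq> 0"
    using False s t by (simp_all add: S_def T_def sum_coordinates_eq_0_iff)
  moreover have "0 \<le> S" "0 \<le> T"
    using s t by (simp_all add: S_def T_def sum_nonneg)
  ultimately have pos: "0 < S" "0 < T" by simp_all
  have "p \<in> simplex_Omega" "q \<in> simplex_Omega"
    using normalized_in_simplex[of s] normalized_in_simplex[of t] False s t
    by (simp_all add: p_def q_def S_def T_def)
  moreover have "convex_on simplex_Omega \<psi>"
    using \<psi> by (simp add: Psi_def)
  ultimately have cvx: "\<psi> ((1 - T / (S + T)) *\<^sub>R p + (T / (S + T)) *\<^sub>R q)
      \<le> (1 - T / (S + T)) * \<psi> p + T / (S + T) * \<psi> q"
    using pos by (intro convex_onD) auto
  have weight: "1 - T / (S + T) = S / (S + T)"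
    using pos by (simp add: field_simps)
  then have "(1 - T / (S + T)) *\<^sub>R p + (T / (S + T)) *\<^sub>R q = (\<chi> i. (s + t) $ i / (S + T))"
    using pos by (simp add: vec_eq_iff p_def q_def add_divide_distrib)
  with cvx pos have "(S + T) * \<psi> (\<chi> i. (s + t) $ i / (S + T))
      \<le> (S + T) * ((1 - T / (S + T)) * \<psi> p + T / (S + T) * \<psi> q)"
    by simp
  also have "\<dots> = S * \<psi> p + T * \<psi> q"
    using pos unfolding weight by (simp add: distrib_left)
  finally show ?thesis
    by (simp add: hom_ext_def Let_def S_def T_def p_def q_def sum.distrib)
qed auto

lemma hom_ext_axis:
  assumes "\<psi> \<in> Psi"
  shows "hom_ext \<psi> (axis i c) = c"
proof -
  have "(\<Sum>k\<in>UNIV. axis i (1::real) $ k) = 1"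
    by (simp add: axis_def)
  then have "hom_ext \<psi> (axis i 1) = 1"
    using assms by (simp add: hom_ext_def Psi_def)
  moreover have "axis i c = c *\<^sub>R axis i 1"
    by (simp add: axis_def vec_eq_iff)
  ultimately show ?thesis
    by (simp add: hom_ext_scaleR)
qed

text \<open>
  Clearing a coordinate of a multiple of \<open>axis i 1\<close> yields \<open>0\<close>, which has no normalisation; this case is
  not covered by the inequality in \<open>Psi\<close> and holds because \<open>\<psi>\<close> is \<open>1\<close> at the vertices.
\<close>

lemma hom_ext_clear_coordinate_le:
  fixes s :: "real ^ 'n"
  assumes \<psi>: "\<psi> \<in> Psi" and s: "\<And>i. 0 \<le> s $ i"
  shows "hom_ext \<psi> (\<chi> j. if j = i then 0 else s $ j) \<le> hom_ext \<psi> s"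
proof (cases "(\<chi> j. if j = i then 0 else s $ j) = 0")
  case True
  have "s $ j = 0" if "j \<noteq> i" for j
    using arg_cong[OF True, of "\<lambda>v. v $ j"] that by simp
  then have "s = axis i (s $ i)"
    by (simp add: vec_eq_iff axis_def)
  then have "hom_ext \<psi> s = s $ i"
    using hom_ext_axis[OF \<psi>] by metis
  with True s[of i] show ?thesis by simp
next
  case False
  define z :: "real ^ 'n" where "z = (\<chi> j. if j = i then 0 else s $ j)"
  define S where "S = (\<Sum>j\<in>UNIV. s $ j)"
  have sum_z: "(\<Sum>j\<in>UNIV. z $ j) = S - s $ i"
    by (simp add: z_def S_def sum.remove[of UNIV i])
  have "0 \<le> z $ j" for j
    using s by (simp add: z_def)
  then have "(\<Sum>j\<in>UNIV. z $ j) \<noteq> 0" "(\<Sum>j\<in>UNIV. z $ j) \<ge> 0"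
    using False by (simp_all add: sum_coordinates_eq_0_iff sum_nonneg flip: z_def)
  then have less: "s $ i < S" and S: "0 < S"
    using s[of i] by (simp_all add: sum_z)
  define t :: "real ^ 'n" where "t = (\<chi> j. s $ j / S)"
  have "s \<noteq> 0" using S by (auto simp: S_def)
  then have "t \<in> simplex_Omega"
    using normalized_in_simplex[of s] s by (simp add: t_def S_def)
  moreover have "t $ i < 1"
    using less S by (simp add: t_def)
  ultimately have "(1 - t $ i) * \<psi> (\<chi> j. if j = i then 0 else t $ j / (1 - t $ i)) \<le> \<psi> t"
    using \<psi> by (simp add: Psi_def)
  moreover have "(\<chi> j. if j = i then 0 else t $ j / (1 - t $ i)) = (\<chi> j. z $ j / (S - s $ i))"
    using less S by (simp add: vec_eq_iff t_def z_def field_simps)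
  ultimately have "S * ((1 - t $ i) * \<psi> (\<chi> j. z $ j / (S - s $ i))) \<le> S * \<psi> t"
    using S by simp
  moreover have "S * (1 - t $ i) = S - s $ i"
    using S by (simp add: t_def field_simps)
  ultimately have "(S - s $ i) * \<psi> (\<chi> j. z $ j / (S - s $ i)) \<le> S * \<psi> t"
    by (metis mult.assoc)
  then have "hom_ext \<psi> z \<le> hom_ext \<psi> s"
    by (simp add: hom_ext_def Let_def sum_z t_def flip: S_def)
  then show ?thesis by (simp add: z_def)
qed

text \<open>
  The vector with the lowered coordinate lies on the segment from the vector with the cleared coordinate
  to \<open>s\<close>, so its value is at most the larger one of the values at the two ends.
\<close>

lemma hom_ext_decrease_coordinate_le:
  fixes s :: "real ^ 'n"
  assumes \<psi>: "\<psi> \<in> Psi" and s: "\<And>i. 0 \<le> s $ i" and u: "0 \<le> u" "u \<le> s $ i"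
  shows "hom_ext \<psi> (\<chi> j. if j = i then u else s $ j) \<le> hom_ext \<psi> s"
proof (cases "s $ i = 0")
  case True
  then have "(\<chi> j. if j = i then u else s $ j) = s"
    using u by (simp add: vec_eq_iff)
  then show ?thesis by simp
next
  case False
  define z :: "real ^ 'n" where "z = (\<chi> j. if j = i then 0 else s $ j)"
  define r where "r = u / s $ i"
  have r: "0 \<le> r" "r \<le> 1"
    using u False s[of i] by (simp_all add: r_def)
  have "(\<chi> j. if j = i then u else s $ j) = (1 - r) *\<^sub>R z + r *\<^sub>R s"
    using False by (simp add: vec_eq_iff z_def r_def field_simps)
  then have "hom_ext \<psi> (\<chi> j. if j = i then u else s $ j)
      \<le> (1 - r) * hom_ext \<psi> z + r * hom_ext \<psi> s"
    using hom_ext_add_le[OF \<psi>, of "(1 - r) *\<^sub>R z" "r *\<^sub>R s"] s r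
    by (simp add: hom_ext_scaleR z_def)
  also have "\<dots> \<le> (1 - r) * hom_ext \<psi> s + r * hom_ext \<psi> s"
    using hom_ext_clear_coordinate_le[OF \<psi> s, of i] r
    by (simp add: z_def mult_left_mono)
  finally show ?thesis by (simp add: algebra_simps)
qed

text \<open>Lower the coordinates from \<open>s\<close> to \<open>t\<close> one after the other.\<close>

lemma hom_ext_mono:
  fixes s t :: "real ^ 'n"
  assumes \<psi>: "\<psi> \<in> Psi" and t: "\<And>i. 0 \<le> t $ i" and le: "\<And>i. t $ i \<le> s $ i"
  shows "hom_ext \<psi> t \<le> hom_ext \<psi> s"
proof -
  have s: "0 \<le> s $ i" for i
    using t le order_trans by blast
  have "hom_ext \<psi> (\<chi> j. if j \<in> A then t $ j else s $ j) \<le> hom_ext \<psi> s" for A :: "'n set"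
    using finite[of A]
  proof induction
    case (insert i A)
    define w :: "real ^ 'n" where "w = (\<chi> j. if j \<in> A then t $ j else s $ j)"
    have "(\<chi> j. if j \<in> insert i A then t $ j else s $ j) = (\<chi> j. if j = i then t $ i else w $ j)"
      by (auto simp: vec_eq_iff w_def)
    then have "hom_ext \<psi> (\<chi> j. if j \<in> insert i A then t $ j else s $ j) \<le> hom_ext \<psi> w"
      using hom_ext_decrease_coordinate_le[OF \<psi>, of w "t $ i" i] s t le insert.hyps
      by (simp add: w_def)
    with insert.IH show ?case by (simp add: w_def)
  qed simp
  from this[of UNIV] show ?thesis by simp
qed

lemma hom_ext_ge_coordinate:
  fixes s :: "real ^ 'n"
  assumes \<psi>: "\<psi> \<in> Psi" and s: "\<And>i. 0 \<le> s $ i"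
  shows "s $ i \<le> hom_ext \<psi> s"
proof -
  have "hom_ext \<psi> (axis i (s $ i)) \<le> hom_ext \<psi> s"
    using s by (intro hom_ext_mono[OF \<psi>]) (simp_all add: axis_def)
  then show ?thesis by (simp add: hom_ext_axis[OF \<psi>])
qed

lemma hom_ext_nonneg:
  fixes s :: "real ^ 'n"
  assumes "\<psi> \<in> Psi" "\<And>i. 0 \<le> s $ i"
  shows "0 \<le> hom_ext \<psi> s"
  using hom_ext_ge_coordinate[OF assms] assms(2) order_trans by blast

section \<open>The product metric\<close>

lemma mem_prod_carrier_iff: "x \<in> prod_carrier X \<longleftrightarrow> (\<forall>i. x i \<in> X i)"
  by (auto simp: prod_carrier_def)

text \<open>
  Outside the carrier the formula can fail for \<open>x = y\<close>: there the distance of a point to itself need not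
  vanish, while \<open>psi_dist\<close> of equal points is \<open>0\<close>.
\<close>

lemma psi_dist_eq_hom_ext:
  assumes "\<And>i. Metric_space (X i) (d i)" "\<And>i. x i \<in> X i"
  shows "psi_dist \<psi> d x y = hom_ext \<psi> (\<chi> i. d i (x i) (y i))"
proof (cases "x = y")
  case True
  then have "d i (x i) (y i) = 0" for i
    using Metric_space.zero[OF assms(1), of "x i" i "x i"] assms(2) by simp
  with True show ?thesis by (simp add: psi_dist_def hom_ext_def)
qed (simp add: psi_dist_def hom_ext_def)

lemma Metric_space_psi_dist:
  fixes X :: "'n::finite \<Rightarrow> 'a set"
  assumes \<psi>: "\<psi> \<in> Psi" and X: "\<And>i. Metric_space (X i) (d i)"
  shows "Metric_space (prod_carrier X) (psi_dist \<psi> d)"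
proof
  have nonneg: "0 \<le> d i a b" for i a b
    using Metric_space.nonneg[OF X] .
  have eq: "psi_dist \<psi> d x y = hom_ext \<psi> (\<chi> i. d i (x i) (y i))" if "x \<in> prod_carrier X" for x y
    using that by (intro psi_dist_eq_hom_ext[of X d, OF X]) (auto simp: mem_prod_carrier_iff)
  show "0 \<le> psi_dist \<psi> d x y" for x y
    using hom_ext_nonneg[OF \<psi>, of "\<chi> i. d i (x i) (y i)"] nonneg
    by (auto simp: psi_dist_def hom_ext_def)
  show "psi_dist \<psi> d x y = psi_dist \<psi> d y x" for x y
  proof -
    have "d i (x i) (y i) = d i (y i) (x i)" for i
      using Metric_space.commute[OF X] .
    then show ?thesis by (simp add: psi_dist_def eq_commute[of x y])
  qed
  show "psi_dist \<psi> d x y = 0 \<longleftrightarrow> x = y" if "x \<in> prod_carrier X" "y \<in> prod_carrier X" for x y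
  proof
    assume "psi_dist \<psi> d x y = 0"
    then have "d i (x i) (y i) \<le> 0" for i
      using hom_ext_ge_coordinate[OF \<psi>, of "\<chi> i. d i (x i) (y i)" i] nonneg eq[OF that(1)] by simp
    then have "d i (x i) (y i) = 0" for i
      using nonneg by (simp add: order_antisym)
    then have "x i = y i" for i
      using Metric_space.zero[OF X, of "x i" i "y i"] that by (auto simp: mem_prod_carrier_iff)
    then show "x = y" by auto
  qed (simp add: psi_dist_def)
  show "psi_dist \<psi> d x z \<le> psi_dist \<psi> d x y + psi_dist \<psi> d y z"
    if "x \<in> prod_carrier X" "y \<in> prod_carrier X" "z \<in> prod_carrier X" for x y z
  proof -
    have "d i (x i) (z i) \<le> d i (x i) (y i) + d i (y i) (z i)" for i
      using that by (intro Metric_space.triangle[OF X]) (auto simp: mem_prod_carrier_iff)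
    then have "hom_ext \<psi> (\<chi> i. d i (x i) (z i))
        \<le> hom_ext \<psi> ((\<chi> i. d i (x i) (y i)) + (\<chi> i. d i (y i) (z i)))"
      using nonneg by (intro hom_ext_mono[OF \<psi>]) simp_all
    also have "\<dots> \<le> hom_ext \<psi> (\<chi> i. d i (x i) (y i)) + hom_ext \<psi> (\<chi> i. d i (y i) (z i))"
      using nonneg by (intro hom_ext_add_le[OF \<psi>]) simp_all
    finally show ?thesis using eq that by simp
  qed
qed

section \<open>Curves of constant speed\<close>

text \<open>
  This is stronger than constant metric speed in the sense of arc length: distances, and not only lengths,
  are proportional to the parameter.
\<close>

definition constant_speed ::
    "'a set \<Rightarrow> ('a \<Rightarrow> 'a \<Rightarrow> real) \<Rightarrow> real \<Rightarrow> real \<Rightarrow> real \<Rightarrow> (real \<Rightarrow> 'a) \<Rightarrow> bool" where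
  "constant_speed X d v a b \<sigma> \<longleftrightarrow>
     (\<forall>t\<in>{a..b}. \<sigma> t \<in> X) \<and> (\<forall>t\<in>{a..b}. \<forall>t'\<in>{a..b}. d (\<sigma> t) (\<sigma> t') = v * \<bar>t - t'\<bar>)"

lemma curve_imp_in_carrier:
  assumes "Metric_space X d" "curve X d a b \<sigma>" "t \<in> {a..b}"
  shows "\<sigma> t \<in> X"
proof -
  interpret Metric_space X d by fact
  show ?thesis
    using assms(2,3) continuous_map_image_subset_topspace by (fastforce simp: curve_def)
qed

lemma constant_speed_imp_curve:
  assumes "Metric_space X d" "constant_speed X d v a b \<sigma>" "a \<le> b"
  shows "curve X d a b \<sigma>"
proof -
  interpret Metric_space X d by fact
  have "Lipschitz_continuous_map (submetric euclidean_metric {a..b}) (metric (X, d)) \<sigma>"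
    using assms(2) Metric_space_axioms
    unfolding Lipschitz_continuous_map_def constant_speed_def
    by (auto simp: mspace_metric mdist_metric dist_real_def intro!: exI[of _ v])
  then have "continuous_map (mtopology_of (submetric euclidean_metric {a..b}))
      (mtopology_of (metric (X, d))) \<sigma>"
    by (rule Lipschitz_continuous_imp_continuous_map)
  then show ?thesis
    using assms(3) by (simp add: curve_def mtopology_of_submetric)
qed

lemma geodesic_iff_unit_speed:
  assumes "Metric_space X d"
  shows "geodesic X d a b \<sigma> \<longleftrightarrow> a \<le> b \<and> constant_speed X d 1 a b \<sigma>"
  using constant_speed_imp_curve[OF assms, of 1 a b \<sigma>] curve_imp_in_carrier[OF assms, of a b \<sigma>]
  by (auto simp: geodesic_def constant_speed_def curve_def)

text \<open>
  A curve of speed \<open>v\<close> on \<open>[a, b]\<close> is reparametrised to unit speed on \<open>[0, v * (b - a)]\<close>; the disjunct of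
  constant curves is the case \<open>v = 0\<close>.
\<close>

lemma affinely_geodesic_iff_constant_speed:
  assumes X: "Metric_space X d" and ab: "a < b"
  shows "affinely_geodesic X d a b \<sigma> \<longleftrightarrow> (\<exists>v\<ge>0. constant_speed X d v a b \<sigma>)"
proof
  interpret Metric_space X d by fact
  assume affine: "affinely_geodesic X d a b \<sigma>"
  then have "curve X d a b \<sigma>" by (simp add: affinely_geodesic_def)
  then have in_X: "\<sigma> t \<in> X" if "t \<in> {a..b}" for t
    using curve_imp_in_carrier[OF X] that by blast
  from affine consider "\<sigma> constant_on {a..b}"
    | c e \<sigma>' where "geodesic X d c e \<sigma>'"
        "\<And>t. t \<in> {a..b} \<Longrightarrow> \<sigma> t = \<sigma>' (((e - c) * t + b * c - a * e) / (b - a))"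
    unfolding affinely_geodesic_def by blast
  then show "\<exists>v\<ge>0. constant_speed X d v a b \<sigma>"
  proof cases
    case 1
    then have "d (\<sigma> t) (\<sigma> t') = 0" if "t \<in> {a..b}" "t' \<in> {a..b}" for t t'
      using in_X that by (metis constant_on_def zero)
    then have "constant_speed X d 0 a b \<sigma>"
      using in_X unfolding constant_speed_def mult_zero_left by blast
    then show ?thesis by (intro exI[of _ 0]) simp
  next
    case 2
    define v where "v = (e - c) / (b - a)"
    define \<theta> where "\<theta> t = ((e - c) * t + b * c - a * e) / (b - a)" for t
    have ce: "c \<le> e"
      using 2(1) by (simp add: geodesic_def curve_def)
    then have v: "0 \<le> v" using ab by (simp add: v_def)
    have \<theta>_lower: "\<theta> t = c + v * (t - a)" and \<theta>_upper: "\<theta> t = e - v * (b - t)" for t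
      using ab by (simp_all add: \<theta>_def v_def field_simps)
    have "\<theta> t \<in> {c..e}" if "t \<in> {a..b}" for t
    proof -
      have "0 \<le> v * (t - a)" "0 \<le> v * (b - t)"
        using v that by simp_all
      then show ?thesis using \<theta>_lower[of t] \<theta>_upper[of t] by simp
    qed
    moreover have "\<bar>\<theta> t - \<theta> t'\<bar> = v * \<bar>t - t'\<bar>" for t t'
    proof -
      have "\<theta> t - \<theta> t' = v * (t - t')" by (simp add: \<theta>_lower algebra_simps)
      then show ?thesis using v by (simp add: abs_mult)
    qed
    ultimately have "constant_speed X d v a b \<sigma>"
      using 2 in_X unfolding geodesic_def constant_speed_def by (simp flip: \<theta>_def)
    with v show ?thesis by blast
  qed
next
  interpret Metric_space X d by fact
  assume "\<exists>v\<ge>0. constant_speed X d v a b \<sigma>"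
  then obtain v where v: "0 \<le> v" and speed: "constant_speed X d v a b \<sigma>" by blast
  have curve: "curve X d a b \<sigma>"
    using constant_speed_imp_curve[OF X speed] ab by simp
  show "affinely_geodesic X d a b \<sigma>"
  proof (cases "v = 0")
    case True
    have "\<sigma> t = \<sigma> a" if t: "t \<in> {a..b}" for t
    proof -
      have a: "a \<in> {a..b}" using ab by simp
      with speed t have "d (\<sigma> t) (\<sigma> a) = v * \<bar>t - a\<bar>" "\<sigma> t \<in> X" "\<sigma> a \<in> X"
        unfolding constant_speed_def by blast+
      then show ?thesis using True by simp
    qed
    then have "\<sigma> constant_on {a..b}" unfolding constant_on_def by blast
    with curve show ?thesis by (simp add: affinely_geodesic_def)
  next
    case False
    with v have v: "0 < v" by simp
    define \<sigma>' where "\<sigma>' s = \<sigma> (a + s / v)" for s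
    have dom: "a + s / v \<in> {a..b}" if "s \<in> {0..v * (b - a)}" for s
      using that v by (simp add: field_simps)
    have "v * \<bar>s / v - s' / v\<bar> = \<bar>s - s'\<bar>" for s s'
      using v by (simp flip: diff_divide_distrib)
    then have "constant_speed X d 1 0 (v * (b - a)) \<sigma>'"
      using speed dom by (simp add: constant_speed_def \<sigma>'_def)
    then have "geodesic X d 0 (v * (b - a)) \<sigma>'"
      using v ab by (simp add: geodesic_iff_unit_speed[OF X])
    moreover have "\<sigma> t = \<sigma>' (((v * (b - a) - 0) * t + b * 0 - a * (v * (b - a))) / (b - a))" for t
    proof -
      have "((v * (b - a) - 0) * t + b * 0 - a * (v * (b - a))) / (b - a) = v * (t - a)"
        using ab by (simp add: field_simps)
      then show ?thesis using v by (simp add: \<sigma>'_def)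
    qed
    ultimately show ?thesis
      using curve unfolding affinely_geodesic_def by blast
  qed
qed

text \<open>The sum over any partition telescopes to the same value.\<close>

lemma curve_length_constant_speed:
  assumes speed: "constant_speed X d v a b \<sigma>" and v: "0 \<le> v" and ab: "a < b"
  shows "curve_length d a b \<sigma> = ennreal (v * (b - a))"
proof -
  have partition_sum: "(\<Sum>i=1..m. ennreal (d (\<sigma> (t (i - 1))) (\<sigma> (t i)))) = ennreal (v * (b - a))"
    if t: "t 0 = a" "t m = b" and less: "\<forall>i\<in>{1..m}. t (i - 1) < t i" for m :: nat and t
  proof -
    have mono: "t i \<le> t j" if "i \<le> j" "j \<le> m" for i j
      using that
    proof (induction j rule: dec_induct)
      case (step j)
      then show ?case using less[rule_format, of "Suc j"] by simp
    qed simp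
    have "d (\<sigma> (t (i - 1))) (\<sigma> (t i)) = v * (t i - t (i - 1))" if "i \<in> {1..m}" for i
    proof -
      have "t (i - 1) \<in> {a..b}" "t i \<in> {a..b}"
        using mono[of 0 "i - 1"] mono[of "i - 1" m] mono[of 0 i] mono[of i m] t that by auto
      then show ?thesis
        using speed less that by (simp add: constant_speed_def abs_if)
    qed
    then have "(\<Sum>i=1..m. ennreal (d (\<sigma> (t (i - 1))) (\<sigma> (t i))))
        = (\<Sum>i=1..m. ennreal (v * (t i - t (i - 1))))"
      by simp
    also have "\<dots> = ennreal (\<Sum>i=1..m. v * (t i - t (i - 1)))"
      using v less by (intro sum_ennreal) (simp add: less_imp_le)
    also have "(\<Sum>i=1..m. v * (t i - t (i - 1))) = v * (t m - t 0)"
      by (induction m) (simp_all add: algebra_simps)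
    finally show ?thesis using t by simp
  qed
  define P where "P = {(\<Sum>i=1..m. ennreal (d (\<sigma> (t (i - 1))) (\<sigma> (t i)))) | (m::nat) (t :: nat \<Rightarrow> real).
      1 \<le> m \<and> t 0 = a \<and> t m = b \<and> (\<forall>i\<in>{1..m}. t (i - 1) < t i)}"
  have "z = ennreal (v * (b - a))" if "z \<in> P" for z
  proof -
    from that obtain m :: nat and t where z: "z = (\<Sum>i=1..m. ennreal (d (\<sigma> (t (i - 1))) (\<sigma> (t i))))"
      and t: "t 0 = a" "t m = b" "\<forall>i\<in>{1..m}. t (i - 1) < t i"
      unfolding P_def by blast
    then show ?thesis by (simp only: z partition_sum[OF t])
  qed
  moreover have "P \<noteq> {}"
  proof -
    define t where "t i = (if i = 0 then a else b)" for i :: nat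
    have "t 0 = a \<and> t 1 = b \<and> (\<forall>i\<in>{1..1}. t (i - 1) < t i)"
      using ab by (simp add: t_def)
    then show ?thesis unfolding P_def by blast
  qed
  ultimately have "P = {ennreal (v * (b - a))}" by blast
  then show ?thesis by (simp add: curve_length_def P_def)
qed

lemma constant_speed_psi_dist:
  fixes X :: "'n::finite \<Rightarrow> 'a set"
  assumes X: "\<And>i. Metric_space (X i) (d i)"
    and speed: "\<And>i. constant_speed (X i) (d i) (v $ i) a b (\<sigma> i)"
  shows "constant_speed (prod_carrier X) (psi_dist \<psi> d) (hom_ext \<psi> v) a b (\<lambda>t i. \<sigma> i t)"
proof -
  have in_X: "\<sigma> i t \<in> X i" if "t \<in> {a..b}" for i t
    using speed that by (simp add: constant_speed_def)
  have "psi_dist \<psi> d (\<lambda>i. \<sigma> i t) (\<lambda>i. \<sigma> i t') = hom_ext \<psi> v * \<bar>t - t'\<bar>"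
    if t: "t \<in> {a..b}" "t' \<in> {a..b}" for t t'
  proof -
    have "psi_dist \<psi> d (\<lambda>i. \<sigma> i t) (\<lambda>i. \<sigma> i t') = hom_ext \<psi> (\<chi> i. d i (\<sigma> i t) (\<sigma> i t'))"
      using in_X t by (intro psi_dist_eq_hom_ext[of X d, OF X]) simp
    also have "(\<chi> i. d i (\<sigma> i t) (\<sigma> i t')) = \<bar>t - t'\<bar> *\<^sub>R v"
      using speed t by (simp add: vec_eq_iff constant_speed_def)
    finally show ?thesis by (simp add: hom_ext_scaleR)
  qed
  then show ?thesis
    using in_X by (simp add: constant_speed_def mem_prod_carrier_iff)
qed

text \<open>
  Run through the geodesics of the factors simultaneously, each slowed down so that they all arrive at
  time \<open>D\<close>, the distance in the product; by homogeneity the resulting speed in the product is \<open>1\<close>.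
\<close>

lemma geodesic_space_psi_dist:
  fixes X :: "'n::finite \<Rightarrow> 'a set"
  assumes \<psi>: "\<psi> \<in> Psi" and geo: "\<And>i. geodesic_space (X i) (d i)"
  shows "geodesic_space (prod_carrier X) (psi_dist \<psi> d)"
  unfolding geodesic_space_def
proof (intro conjI ballI)
  have X: "Metric_space (X i) (d i)" for i
    using geo by (simp add: geodesic_space_def)
  show M: "Metric_space (prod_carrier X) (psi_dist \<psi> d)"
    using Metric_space_psi_dist[of _ X d, OF \<psi> X] .
  fix x y assume x: "x \<in> prod_carrier X" and y: "y \<in> prod_carrier X"
  define D where "D = psi_dist \<psi> d x y"
  define l where "l i = d i (x i) (y i)" for i
  have l: "0 \<le> l i" for i
    using Metric_space.nonneg[OF X] by (simp add: l_def)
  have D: "D = hom_ext \<psi> (\<chi> i. l i)"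
    unfolding D_def l_def
    using x by (intro psi_dist_eq_hom_ext[of X d, OF X]) (auto simp: mem_prod_carrier_iff)
  have "\<exists>\<gamma>. geodesic (X i) (d i) 0 (l i) \<gamma> \<and> \<gamma> 0 = x i \<and> \<gamma> (l i) = y i" for i
    using geo[of i] x y by (auto simp: geodesic_space_def mem_prod_carrier_iff l_def)
  then obtain \<gamma> where \<gamma>: "geodesic (X i) (d i) 0 (l i) (\<gamma> i)" "\<gamma> i 0 = x i" "\<gamma> i (l i) = y i" for i
    by metis
  show "\<exists>\<gamma>. geodesic (prod_carrier X) (psi_dist \<psi> d) 0 (psi_dist \<psi> d x y) \<gamma>
      \<and> \<gamma> 0 = x \<and> \<gamma> (psi_dist \<psi> d x y) = y"
  proof (cases "D = 0")
    case True
    then have "x = y"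
      using Metric_space.zero[OF M x y] by (simp add: D_def)
    moreover have "geodesic (prod_carrier X) (psi_dist \<psi> d) 0 0 (\<lambda>_. x)"
      using x by (simp add: geodesic_iff_unit_speed[OF M] constant_speed_def psi_dist_def)
    ultimately show ?thesis
      using True by (auto simp: D_def)
  next
    case False
    then have D_pos: "0 < D"
      using Metric_space.nonneg[OF M, of x y] by (simp add: D_def)
    define v :: "real ^ 'n" where "v = (1 / D) *\<^sub>R (\<chi> i. l i)"
    have v: "0 \<le> v $ i" "v $ i * D = l i" for i
      using l D_pos by (simp_all add: v_def)
    have "constant_speed (X i) (d i) (v $ i) 0 D (\<lambda>s. \<gamma> i (v $ i * s))" for i
    proof -
      have unit: "constant_speed (X i) (d i) 1 0 (l i) (\<gamma> i)"
        using \<gamma>(1) by (simp add: geodesic_iff_unit_speed[OF X])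
      have "v $ i * s \<in> {0..l i}" if "s \<in> {0..D}" for s
        using that v(1)[of i] mult_left_mono[of s D "v $ i"] by (simp add: v(2))
      moreover have "\<bar>v $ i * s - v $ i * s'\<bar> = v $ i * \<bar>s - s'\<bar>" for s s'
        using v(1)[of i] by (simp add: abs_mult flip: right_diff_distrib)
      ultimately show ?thesis
        using unit by (simp add: constant_speed_def)
    qed
    then have "constant_speed (prod_carrier X) (psi_dist \<psi> d) (hom_ext \<psi> v) 0 D
        (\<lambda>s i. \<gamma> i (v $ i * s))"
      using constant_speed_psi_dist[of X, OF X, of v 0 D "\<lambda>i s. \<gamma> i (v $ i * s)" \<psi>] by simp
    moreover have "hom_ext \<psi> v = 1"
      unfolding v_def hom_ext_scaleR D[symmetric] using False by simp
    ultimately have "geodesic (prod_carrier X) (psi_dist \<psi> d) 0 D (\<lambda>s i. \<gamma> i (v $ i * s))"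
      using D_pos by (simp add: geodesic_iff_unit_speed[OF M])
    then show ?thesis
      using \<gamma>(2,3) v(2) by (intro exI[of _ "\<lambda>s i. \<gamma> i (v $ i * s)"]) (simp flip: D_def)
  qed
qed

section \<open>Products of affinely geodesic curves\<close>

theorem theorem7p10:
  fixes X :: "'n::finite \<Rightarrow> 'a set"
    and d :: "'n \<Rightarrow> 'a \<Rightarrow> 'a \<Rightarrow> real"
    and x y :: "'n \<Rightarrow> 'a"
    and \<sigma> :: "'n \<Rightarrow> real \<Rightarrow> 'a"
    and \<psi> :: "real ^ 'n \<Rightarrow> real"
  assumes "CARD('n) \<ge> 2"
    and "\<And>i. geodesic_space (X i) (d i)"
    and "\<And>i. x i \<in> X i"
    and "\<And>i. y i \<in> X i"
    and "\<And>i. affinely_geodesic (X i) (d i) 0 1 (\<sigma> i)"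
    and "\<And>i. \<sigma> i 0 = x i"
    and "\<And>i. \<sigma> i 1 = y i"
    and "\<psi> \<in> Psi"
  shows "geodesic_space (prod_carrier X) (psi_dist \<psi> d)
    \<and> affinely_geodesic (prod_carrier X) (psi_dist \<psi> d) 0 1 (\<lambda>t i. \<sigma> i t)
    \<and> (\<lambda>i. \<sigma> i 0) = x \<and> (\<lambda>i. \<sigma> i 1) = y
    \<and> (\<forall>i. curve_length (d i) 0 1 (\<sigma> i) < \<infinity>)
    \<and> curve_length (psi_dist \<psi> d) 0 1 (\<lambda>t i. \<sigma> i t) < \<infinity>
    \<and> (let L = (\<lambda>i. enn2real (curve_length (d i) 0 1 (\<sigma> i)));
           S = (\<Sum>i\<in>UNIV. L i)
       in enn2real (curve_length (psi_dist \<psi> d) 0 1 (\<lambda>t i. \<sigma> i t))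
            = (if S = 0 then 0 else S * \<psi> (\<chi> i. L i / S)))"
proof -
  have X: "Metric_space (X i) (d i)" for i
    using assms(2) by (simp add: geodesic_space_def)
  have "\<exists>v\<ge>0. constant_speed (X i) (d i) v 0 1 (\<sigma> i)" for i
    using assms(5) affinely_geodesic_iff_constant_speed[OF X] by simp
  then obtain w where w: "0 \<le> w i" "constant_speed (X i) (d i) (w i) 0 1 (\<sigma> i)" for i
    by metis
  define v where "v = (\<chi> i. w i)"
  have geo: "geodesic_space (prod_carrier X) (psi_dist \<psi> d)"
    using geodesic_space_psi_dist[OF assms(8,2)] .
  then have M: "Metric_space (prod_carrier X) (psi_dist \<psi> d)"
    by (simp add: geodesic_space_def)
  have speed: "constant_speed (prod_carrier X) (psi_dist \<psi> d) (hom_ext \<psi> v) 0 1 (\<lambda>t i. \<sigma> i t)"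
    using constant_speed_psi_dist[of X d, OF X] w(2) by (simp add: v_def)
  have nonneg: "0 \<le> hom_ext \<psi> v"
    using hom_ext_nonneg[OF assms(8)] w(1) by (simp add: v_def)
  have "affinely_geodesic (prod_carrier X) (psi_dist \<psi> d) 0 1 (\<lambda>t i. \<sigma> i t)"
    using affinely_geodesic_iff_constant_speed[OF M] speed nonneg by auto
  moreover have "curve_length (d i) 0 1 (\<sigma> i) = ennreal (w i)" for i
    using curve_length_constant_speed[OF w(2,1)] by simp
  moreover have "curve_length (psi_dist \<psi> d) 0 1 (\<lambda>t i. \<sigma> i t) = ennreal (hom_ext \<psi> v)"
    using curve_length_constant_speed[OF speed nonneg] by simp
  ultimately show ?thesis
    using geo assms(6,7) w(1) nonneg by (simp add: hom_ext_def v_def Let_def)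
qed

end
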